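(* For every positive integer $n$, \[ \sum_{m=1}^{2^{n}} g(m)=\frac{4^{n}+6^{n}}{2}. \]
   Context: For a positive integer $m$, the chocolate game $C_{m,m}$ is a two-player impartial game on an $m\times m$ chocolate bar of unit cells, exactly one of which is poisoned (known to both players); cells are $(i,j)$ with $1\le i,j\le m$. Players alternately break the current bar along a grid line into two rectangular pieces, eat one and pass the other (always keeping the poisoned cell); a player who receives the $1\times1$ bar loses. A cell is a P-position if with poison there the second player has a winning strategy; $P_{m,m}$ is the set of P-positions. It is known that $(i,j)\in P_{m,m}$ iff $(i-1)\oplus(j-1)\oplus(m-i)\oplus(m-j)=0$ ($\oplus$ = bitwise XOR). Define $g(m)=\#P_{m,m}$. *)

theory Defs
  imports Complex_Main
begin

type_synonym cell = "nat \<times> nat"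

text \<open>\<open>Bar a b c d\<close> is the rectangle of cells \<open>(i, j)\<close> with \<open>a \<le> i \<le> b\<close> and \<open>c \<le> j \<le> d\<close>.\<close>

datatype bar = Bar nat nat nat nat

fun cells :: "bar \<Rightarrow> cell set" where
  "cells (Bar a b c d) = {a..b} \<times> {c..d}"

text \<open>The breaks run along the grid line after row, respectively column, \<open>k\<close>; the bounds on
  \<open>k\<close> make both pieces nonempty.\<close>

inductive breaks_into :: "bar \<Rightarrow> bar \<Rightarrow> bar \<Rightarrow> bool" where
  row: "a \<le> k \<Longrightarrow> k < b \<Longrightarrow> breaks_into (Bar a b c d) (Bar a k c d) (Bar (k + 1) b c d)"
| col: "c \<le> k \<Longrightarrow> k < d \<Longrightarrow> breaks_into (Bar a b c d) (Bar a b c k) (Bar a b (k + 1) d)"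

definition move :: "cell \<Rightarrow> bar \<Rightarrow> bar \<Rightarrow> bool" where
  "move p B B' \<longleftrightarrow> p \<in> cells B' \<and> (\<exists>E. breaks_into B B' E \<or> breaks_into B E B')"

fun single_cell :: "bar \<Rightarrow> bool" where
  "single_cell (Bar a b c d) \<longleftrightarrow> a = b \<and> c = d"

text \<open>A play lists the bars in the order in which they are received. The first player receives
  the initial bar, hence the bars at even indices; the last bar of a play of even length has been
  received by the second player.\<close>

definition play :: "cell \<Rightarrow> bar \<Rightarrow> bar list \<Rightarrow> bool" where
  "play p B h \<longleftrightarrow> h \<noteq> [] \<and> hd h = B \<and> (\<forall>k. Suc k < length h \<longrightarrow> move p (h ! k) (h ! Suc k))"

text \<open>A strategy maps the history of the play to the bar that is passed on.\<close>

definition second_follows :: "(bar list \<Rightarrow> bar) \<Rightarrow> bar list \<Rightarrow> bool" where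
  "second_follows s h \<longleftrightarrow>
     (\<forall>k. odd k \<and> Suc k < length h \<longrightarrow> h ! Suc k = s (take (Suc k) h))"

text \<open>A strategy of the second player is winning if it always prescribes a legal move and every
  play following it that reaches a single cell does so with the first player receiving that cell.
  Each move shrinks the bar, so there are no infinite plays to account for.\<close>

definition second_winning_strategy :: "cell \<Rightarrow> bar \<Rightarrow> (bar list \<Rightarrow> bar) \<Rightarrow> bool" where
  "second_winning_strategy p B s \<longleftrightarrow>
     (\<forall>h. play p B h \<and> second_follows s h \<and> even (length h) \<and> \<not> single_cell (last h)
          \<longrightarrow> move p (last h) (s h)) \<and>
     (\<forall>h. play p B h \<and> second_follows s h \<and> single_cell (last h) \<longrightarrow> odd (length h))"

definition P_positions :: "nat \<Rightarrow> cell set" where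
  "P_positions m =
     {p \<in> {1..m} \<times> {1..m}. \<exists>s. second_winning_strategy p (Bar 1 m 1 m) s}"

definition g :: "nat \<Rightarrow> nat" where
  "g m = card (P_positions m)"

end

theory Submission
  imports Defs
begin

unbundle bit_operations_syntax

text \<open>With the poison at \<open>(i, j)\<close>, the lines on each of its four sides form a Nim heap, so a
  position is lost iff the nim-sum of the four heaps vanishes. Hence \<open>g (s + 1)\<close> counts the
  quadruples with \<open>a + b = c + d = s\<close> and \<open>a XOR b = c XOR d\<close>. Splitting off the lowest bits, such
  a quadruple is an arbitrary choice of \<open>(0, 1)\<close> or \<open>(1, 0)\<close> for each of the two pairs if \<open>s\<close> is
  odd. If \<open>s\<close> is even, the four bits coincide, since \<open>a XOR b\<close> determines the parity of
  \<open>a div 2 + b div 2\<close>. So the counts satisfy \<open>F (2t + 1) = 4 F t\<close> and \<open>F (2t) = F t + F (t - 1)\<close>,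
  whence the sum \<open>S n\<close> of \<open>F s\<close> over \<open>s < 2 ^ n\<close> obeys \<open>S (n + 1) = 6 S n - 4 ^ n\<close>.\<close>

section \<open>Nim-sums\<close>

lemma xor_nat_cancel:
  fixes a b c :: nat
  shows "a XOR c = b XOR c \<longleftrightarrow> a = b" "c XOR a = c XOR b \<longleftrightarrow> a = b"
  by (metis xor.assoc xor.commute xor_self_eq xor.right_neutral)+

lemma xor_nat_eq_0_iff: "a XOR b = 0 \<longleftrightarrow> a = b" for a b :: nat
  by (metis xor_nat_cancel(1) xor_self_eq)

lemma xor_nat_div_2: "(a XOR b) div 2 = a div 2 XOR b div 2" for a b :: nat
  by (simp flip: drop_bit_Suc[of 0, simplified] add: drop_bit_xor)

text \<open>The witness is the position of the leading bit of \<open>z\<close>.\<close>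

lemma xor_decreasing_bit:
  fixes z :: nat
  assumes "z \<noteq> 0"
  shows "\<exists>k. bit z k \<and> (\<forall>x. bit x k \<longrightarrow> x XOR z < x)"
  using assms
proof (induction z rule: less_induct)
  case (less z)
  show ?case
  proof (cases "z div 2 = 0")
    case True
    with less.prems have "z = 1" by simp
    moreover have "x XOR 1 < x" if "odd x" for x :: nat
      using that by (auto elim!: oddE simp: xor_Suc_0_eq)
    ultimately show ?thesis
      by (intro exI[of _ 0]) (auto simp: bit_0)
  next
    case False
    then have "z div 2 < z" by simp
    from less.IH[OF this False] obtain k where
      k: "bit (z div 2) k" "\<And>x. bit x k \<Longrightarrow> x XOR (z div 2) < x" by blast
    have "x XOR z < x" if "bit x (Suc k)" for x
    proof -
      have "(x XOR z) div 2 < x div 2"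
        using k(2)[of "x div 2"] that by (simp add: xor_nat_div_2 bit_Suc)
      then show ?thesis by (meson div_le_mono linorder_not_le)
    qed
    with k(1) show ?thesis by (intro exI[of _ "Suc k"]) (simp add: bit_Suc)
  qed
qed

text \<open>The leading bit of \<open>z\<close> is set in an odd number of the four heaps, hence in
  at least one of them, and adding \<open>z\<close> decreases that heap.\<close>

lemma nim_sum4_reducible:
  fixes a b c d :: nat
  defines "z \<equiv> (a XOR b) XOR (c XOR d)"
  assumes "z \<noteq> 0"
  shows "a XOR z < a \<or> b XOR z < b \<or> c XOR z < c \<or> d XOR z < d"
proof -
  obtain k where k: "bit z k" "\<forall>x. bit x k \<longrightarrow> x XOR z < x"
    using xor_decreasing_bit[OF assms(2)] by blast
  have "bit a k \<or> bit b k \<or> bit c k \<or> bit d k"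
    using k(1) by (auto simp: z_def bit_xor_iff)
  with k(2) show ?thesis by blast
qed

section \<open>The chocolate game as Nim\<close>

fun nim_value :: "cell \<Rightarrow> bar \<Rightarrow> nat" where
  "nim_value (i, j) (Bar a b c d) = ((i - a) XOR (b - i)) XOR ((j - c) XOR (d - j))"

text \<open>Keeping the poisoned piece replaces exactly one of the heaps \<open>b - i\<close>,
  \<open>i - a\<close>, \<open>d - j\<close>, \<open>j - c\<close> by an arbitrary smaller number: a
  move in four-heap Nim.\<close>

lemma move_Bar_iff:
  assumes "(i, j) \<in> cells (Bar a b c d)"
  shows "move (i, j) (Bar a b c d) B' \<longleftrightarrow>
    (\<exists>k. i \<le> k \<and> k < b \<and> B' = Bar a k c d) \<or> (\<exists>k. a \<le> k \<and> k < i \<and> B' = Bar (k + 1) b c d) \<or>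
    (\<exists>k. j \<le> k \<and> k < d \<and> B' = Bar a b c k) \<or> (\<exists>k. c \<le> k \<and> k < j \<and> B' = Bar a b (k + 1) d)"
  using assms unfolding move_def breaks_into.simps
  by (cases B') (auto simp: Suc_le_eq)

lemma move_cells: "move p B B' \<Longrightarrow> p \<in> cells B'"
  by (simp add: move_def)

text \<open>Counts the grid lines left to break along; it is the measure for the induction over
  plays.\<close>

fun bar_size :: "bar \<Rightarrow> nat" where
  "bar_size (Bar a b c d) = (b - a) + (d - c)"

lemma move_bar_size:
  assumes "p \<in> cells B" "move p B B'"
  shows "bar_size B' < bar_size B"
proof -
  obtain i j where p: "p = (i, j)" by (cases p)
  obtain a b c d where B: "B = Bar a b c d" by (cases B)
  show ?thesis
    using assms(2) assms(1) unfolding p B move_Bar_iff[OF assms(1)[unfolded p B]] by auto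
qed

lemma nim_value_single_cell:
  assumes "p \<in> cells B" "single_cell B"
  shows "nim_value p B = 0"
  using assms by (cases B; cases p) auto

text \<open>Only one heap changes, so by cancellation the nim-sum changes too.\<close>

lemma move_from_zero:
  assumes "p \<in> cells B" "nim_value p B = 0" "move p B B'"
  shows "nim_value p B' \<noteq> 0"
proof -
  obtain i j where p: "p = (i, j)" by (cases p)
  obtain a b c d where B: "B = Bar a b c d" by (cases B)
  have "nim_value p B \<noteq> nim_value p B'"
    using assms(3) assms(1) unfolding p B move_Bar_iff[OF assms(1)[unfolded p B]]
    by (auto simp: xor_nat_cancel)
  with assms(2) show ?thesis by simp
qed

lemma move_to_zero:
  assumes "p \<in> cells B" "nim_value p B \<noteq> 0"
  obtains B' where "move p B B'" "nim_value p B' = 0"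
proof -
  obtain i j where p: "p = (i, j)" by (cases p)
  obtain a b c d where B: "B = Bar a b c d" by (cases B)
  have ij: "a \<le> i" "i \<le> b" "c \<le> j" "j \<le> d" using assms(1) by (auto simp: p B)
  note mv = move_Bar_iff[OF assms(1)[unfolded p B]]
  define z where "z = nim_value p B"
  have z: "z = ((i - a) XOR (b - i)) XOR ((j - c) XOR (d - j))" by (simp add: z_def p B)
  from nim_sum4_reducible[of "i - a" "b - i" "j - c" "d - j"] assms(2)
  consider "(i - a) XOR z < i - a" | "(b - i) XOR z < b - i"
    | "(j - c) XOR z < j - c" | "(d - j) XOR z < d - j"
    unfolding z_def[symmetric] z[symmetric] by blast
  then show ?thesis
  proof cases
    case 1
    \<comment> \<open>The first row is chosen so that the heap \<open>i - a\<close> becomes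
      \<open>(i - a) XOR z\<close>. The break runs after the row before it, hence the
      \<open>- 1\<close> in the witness for \<open>k\<close>.\<close>
    let ?B = "Bar (i - ((i - a) XOR z)) b c d"
    have "move p B ?B"
      unfolding p B mv using 1 ij by (intro disjI2 disjI1 exI[of _ "i - ((i - a) XOR z) - 1"]) auto
    moreover have "nim_value p ?B = ((i - a) XOR z XOR (b - i)) XOR ((j - c) XOR (d - j))"
      using 1 by (simp add: p xor.assoc)
    then have "nim_value p ?B = 0"
      by (metis z xor.assoc xor.commute xor_self_eq)
    ultimately show ?thesis by (rule that)
  next
    case 2
    let ?B = "Bar a (i + ((b - i) XOR z)) c d"
    have "move p B ?B"
      unfolding p B mv using 2 ij by auto
    \<comment> \<open>Whichever heap absorbs \<open>z\<close>, commutativity brings the nim-sum into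
      the form of the first case, which is \<open>z XOR z\<close>.\<close>
    moreover have "nim_value p ?B = ((i - a) XOR z XOR (b - i)) XOR ((j - c) XOR (d - j))"
      using 2 by (simp add: p ac_simps)
    then have "nim_value p ?B = 0"
      by (metis z xor.assoc xor.commute xor_self_eq)
    ultimately show ?thesis by (rule that)
  next
    case 3
    let ?B = "Bar a b (j - ((j - c) XOR z)) d"
    have "move p B ?B"
      unfolding p B mv using 3 ij by (intro disjI2 exI[of _ "j - ((j - c) XOR z) - 1"]) auto
    moreover have "nim_value p ?B = ((i - a) XOR z XOR (b - i)) XOR ((j - c) XOR (d - j))"
      using 3 by (simp add: p ac_simps)
    then have "nim_value p ?B = 0"
      by (metis z xor.assoc xor.commute xor_self_eq)
    ultimately show ?thesis by (rule that)
  next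
    case 4
    let ?B = "Bar a b c (j + ((d - j) XOR z))"
    have "move p B ?B"
      unfolding p B mv using 4 ij by auto
    moreover have "nim_value p ?B = ((i - a) XOR z XOR (b - i)) XOR ((j - c) XOR (d - j))"
      using 4 by (simp add: p ac_simps)
    then have "nim_value p ?B = 0"
      by (metis z xor.assoc xor.commute xor_self_eq)
    ultimately show ?thesis by (rule that)
  qed
qed

text \<open>Always restoring nim-sum zero wins: the second player then only receives bars of nonzero
  value, and a single cell has value zero.\<close>

lemma zero_second_wins:
  assumes "p \<in> cells B" "nim_value p B = 0"
  shows "\<exists>s. second_winning_strategy p B s"
proof
  \<comment> \<open>The choice is meaningful only when the value of \<open>last h\<close> is
    nonzero, which is the case whenever the second player is to move.\<close>
  define s where "s h = (SOME B'. move p (last h) B' \<and> nim_value p B' = 0)" for h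
  have s: "move p (last h) (s h) \<and> nim_value p (s h) = 0"
    if "p \<in> cells (last h)" "nim_value p (last h) \<noteq> 0" for h
    unfolding s_def by (rule someI_ex) (use move_to_zero[OF that] in blast)
  have inv: "p \<in> cells (h ! k) \<and> (nim_value p (h ! k) = 0 \<longleftrightarrow> even k)"
    if h: "play p B h" "second_follows s h" and k: "k < length h" for h k
    using k
  proof (induction k)
    case 0
    with h(1) assms show ?case by (auto simp: play_def hd_conv_nth)
  next
    case (Suc k)
    have mv: "move p (h ! k) (h ! Suc k)" using h(1) Suc.prems by (simp add: play_def)
    show ?case
    proof (cases "even k")
      case True
      then show ?thesis using Suc move_from_zero[OF _ _ mv] move_cells[OF mv] by simp
    next
      case False
      have "h ! Suc k = s (take (Suc k) h)"
        using h(2) False Suc.prems by (simp add: second_follows_def)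
      moreover have "last (take (Suc k) h) = h ! k"
        using Suc.prems by (simp add: take_Suc_conv_app_nth)
      ultimately show ?thesis using s[of "take (Suc k) h"] Suc False move_cells[OF mv] by simp
    qed
  qed
  have inv_last: "p \<in> cells (last h) \<and> (nim_value p (last h) = 0 \<longleftrightarrow> odd (length h))"
    if h: "play p B h" "second_follows s h" for h
  proof -
    have "h \<noteq> []" using h(1) by (simp add: play_def)
    \<comment> \<open>The last index is \<open>length h - 1\<close>, so an even index turns into an
      odd length.\<close>
    then show ?thesis using inv[OF h, of "length h - 1"] by (cases h) (auto simp: last_conv_nth)
  qed
  show "second_winning_strategy p B s"
    unfolding second_winning_strategy_def using inv_last s nim_value_single_cell by blast
qed

lemma play_snoc:
  assumes "play p B h" "move p (last h) B'"
  shows "play p B (h @ [B'])"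
  using assms unfolding play_def
  by (auto simp: nth_append less_Suc_eq) (metis diff_Suc_1 last_conv_nth)

text \<open>The new bar has index \<open>length h\<close>, so the strategy constrains it only if
  this length is even.\<close>

lemma second_follows_snoc:
  assumes "second_follows s h" "even (length h) \<Longrightarrow> B' = s h"
  shows "second_follows s (h @ [B'])"
  using assms unfolding second_follows_def
  by (auto simp: nth_append less_Suc_eq) (metis even_Suc)

text \<open>At a nonzero value the first player could move to zero. The reply prescribed by
  \<open>s\<close> would then leave a smaller bar of nonzero value, contradicting the induction
  hypothesis.\<close>

lemma second_winning_imp_zero:
  assumes "second_winning_strategy p B s" "p \<in> cells B"
  shows "nim_value p B = 0"
proof -
  have legal: "move p (last h) (s h)"
    if "play p B h" "second_follows s h" "even (length h)" "\<not> single_cell (last h)" for h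
    using assms(1) that unfolding second_winning_strategy_def by blast
  have wins: "odd (length h)"
    if "play p B h" "second_follows s h" "single_cell (last h)" for h
    using assms(1) that unfolding second_winning_strategy_def by blast
  \<comment> \<open>Generalised to all plays following \<open>s\<close> with the first player to
    move, so that two further moves lead back to the same situation.\<close>
  have *: "nim_value p (last h) = 0"
    if "play p B h" "second_follows s h" "odd (length h)" "p \<in> cells (last h)" for h
    using that
  proof (induction "bar_size (last h)" arbitrary: h rule: less_induct)
    case less
    show ?case
    proof (rule ccontr)
      assume "nim_value p (last h) \<noteq> 0"
      then obtain B' where B': "move p (last h) B'" "nim_value p B' = 0"
        using move_to_zero less.prems(4) by blast
      let ?h1 = "h @ [B']"
      let ?h2 = "?h1 @ [s ?h1]"
      have h1: "play p B ?h1" "second_follows s ?h1" "even (length ?h1)"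
        using less.prems B' by (auto intro: play_snoc second_follows_snoc)
      \<comment> \<open>Otherwise the second player would receive a single cell, so a reply by
        \<open>s\<close> exists.\<close>
      then have "\<not> single_cell (last ?h1)" using wins by blast
      then have mv: "move p B' (s ?h1)" using legal[OF h1] by simp
      then have h2: "play p B ?h2" "second_follows s ?h2"
        using h1 by (auto intro!: play_snoc[of p B ?h1, simplified] second_follows_snoc[of s ?h1, simplified])
      have pB': "p \<in> cells B'" using B'(1) by (rule move_cells)
      have "nim_value p (s ?h1) = 0"
        using less.hyps[of ?h2] h2 less.prems mv move_cells[OF mv]
          move_bar_size[OF less.prems(4) B'(1)] move_bar_size[OF pB' mv] by simp
      with move_from_zero[OF pB' B'(2) mv] show False by contradiction
    qed
  qed
  show ?thesis using *[of "[B]"] assms(2) by (simp add: play_def second_follows_def)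
qed

lemma P_positions_eq:
  "P_positions m = {(i, j) \<in> {1..m} \<times> {1..m}. (i - 1) XOR (m - i) = (j - 1) XOR (m - j)}"
proof -
  have "(\<exists>s. second_winning_strategy (i, j) (Bar 1 m 1 m) s) \<longleftrightarrow>
      (i - 1) XOR (m - i) = (j - 1) XOR (m - j)" (is "?W i j \<longleftrightarrow> ?E i j")
    if "(i, j) \<in> {1..m} \<times> {1..m}" for i j
  proof -
    have "(i, j) \<in> cells (Bar 1 m 1 m)" using that by simp
    then have "(\<exists>s. second_winning_strategy (i, j) (Bar 1 m 1 m) s) \<longleftrightarrow>
        nim_value (i, j) (Bar 1 m 1 m) = 0"
      using zero_second_wins second_winning_imp_zero by blast
    then show ?thesis by (simp add: xor_nat_eq_0_iff)
  qed
  then have "q \<in> {1..m} \<times> {1..m} \<and> (\<exists>s. second_winning_strategy q (Bar 1 m 1 m) s) \<longleftrightarrow>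
      q \<in> {(i, j) \<in> {1..m} \<times> {1..m}. (i - 1) XOR (m - i) = (j - 1) XOR (m - j)}" for q
    by (cases q) blast
  then show ?thesis unfolding P_positions_def by blast
qed

section \<open>Counting\<close>

definition nim_quads :: "nat \<Rightarrow> (nat \<times> nat \<times> nat \<times> nat) set" where
  "nim_quads s = {(a, b, c, d). a + b = s \<and> c + d = s \<and> a XOR b = c XOR d}"

lemma finite_nim_quads [simp]: "finite (nim_quads s)"
  by (rule finite_subset[of _ "{..s} \<times> {..s} \<times> {..s} \<times> {..s}"]) (auto simp: nim_quads_def)

text \<open>The heaps on opposite sides of the poison add up to one less than the side
  length.\<close>

lemma g_Suc: "g (Suc s) = card (nim_quads s)"
proof -
  have "bij_betw (\<lambda>(i, j). (i - 1, Suc s - i, j - 1, Suc s - j))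
      (P_positions (Suc s)) (nim_quads s)"
    by (rule bij_betw_byWitness[where f' = "\<lambda>(a, b, c, d). (Suc a, Suc c)"])
      (auto simp: P_positions_eq nim_quads_def, metis add_diff_cancel_left')
  then show ?thesis by (simp add: g_def bij_betw_same_card)
qed

lemma xor_nat_double:
  fixes a b :: nat
  shows "(2 * a) XOR (2 * b) = 2 * (a XOR b)"
    "Suc (2 * a) XOR (2 * b) = Suc (2 * (a XOR b))"
    "(2 * a) XOR Suc (2 * b) = Suc (2 * (a XOR b))"
    "Suc (2 * a) XOR Suc (2 * b) = 2 * (a XOR b)"
  by (subst xor_rec; simp)+

lemma even_xor_nat_iff: "even (a XOR b) \<longleftrightarrow> even (a + b)" for a b :: nat
  by (simp add: even_xor_iff)

lemma card_nim_quads_odd: "card (nim_quads (Suc (2 * t))) = 4 * card (nim_quads t)"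
proof -
  \<comment> \<open>\<open>e\<close> and \<open>e'\<close> become the lowest bits of the first and
    third entries. An odd sum forces the complementary bits on their partners, so both XORs end in
    1.\<close>
  define f :: "(nat \<times> nat) \<times> nat \<times> nat \<times> nat \<times> nat \<Rightarrow> nat \<times> nat \<times> nat \<times> nat" where
    "f = (\<lambda>((e, e'), a, b, c, d). (2 * a + e, 2 * b + (1 - e), 2 * c + e', 2 * d + (1 - e')))"
  let ?A = "({0, 1 :: nat} \<times> {0, 1 :: nat}) \<times> nim_quads t"
  have inj: "inj_on f ?A"
    by (auto simp: inj_on_def f_def; presburger)
  have "f ` ?A = nim_quads (Suc (2 * t))"
  proof
    show "f ` ?A \<subseteq> nim_quads (Suc (2 * t))"
      by (auto simp: f_def nim_quads_def xor_nat_double)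
    show "nim_quads (Suc (2 * t)) \<subseteq> f ` ?A"
    proof
      fix q assume q: "q \<in> nim_quads (Suc (2 * t))"
      obtain a b c d where [simp]: "q = (a, b, c, d)" by (cases q)
      have abcd: "a + b = Suc (2 * t)" "c + d = Suc (2 * t)" "a XOR b = c XOR d"
        using q by (auto simp: nim_quads_def)
      have "(a div 2, b div 2, c div 2, d div 2) \<in> nim_quads t"
      proof -
        have "a div 2 + b div 2 = t" "c div 2 + d div 2 = t"
          using abcd(1,2) by presburger+
        moreover have "a div 2 XOR b div 2 = c div 2 XOR d div 2"
          using abcd(3) by (simp flip: xor_nat_div_2)
        ultimately show ?thesis by (simp add: nim_quads_def)
      qed
      moreover have "q = f ((a mod 2, c mod 2), a div 2, b div 2, c div 2, d div 2)"
      proof -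
        have "1 - a mod 2 = b mod 2" using abcd(1) by presburger
        moreover have "1 - c mod 2 = d mod 2" using abcd(2) by presburger
        ultimately show ?thesis by (simp add: f_def)
      qed
      ultimately show "q \<in> f ` ?A"
        by (intro image_eqI[where x = "((a mod 2, c mod 2), a div 2, b div 2, c div 2, d div 2)"])
          auto
    qed
  qed
  then have "card (nim_quads (Suc (2 * t))) = card ?A"
    using card_image[OF inj] by simp
  also have "\<dots> = 4 * card (nim_quads t)" by (simp add: card_cartesian_product)
  finally show ?thesis .
qed

text \<open>A common lowest bit 0 leaves halves with sum \<open>Suc t\<close>; a common bit 1 uses
  up 2 of each sum and leaves halves with sum \<open>t\<close>.\<close>

lemma card_nim_quads_even:
  "card (nim_quads (2 * Suc t)) = card (nim_quads (Suc t)) + card (nim_quads t)"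
proof -
  define f :: "nat \<Rightarrow> nat \<times> nat \<times> nat \<times> nat \<Rightarrow> nat \<times> nat \<times> nat \<times> nat" where
    "f e = (\<lambda>(a, b, c, d). (2 * a + e, 2 * b + e, 2 * c + e, 2 * d + e))" for e
  have inj: "inj_on (f e) A" for e A by (auto simp: inj_on_def f_def)
  have disj: "f 0 ` nim_quads (Suc t) \<inter> f 1 ` nim_quads t = {}"
  proof -
    have "f 0 q \<noteq> f 1 q'" for q q'
      using double_not_eq_Suc_double by (auto simp: f_def split: prod.splits)
    then show ?thesis by blast
  qed
  have "nim_quads (2 * Suc t) = f 0 ` nim_quads (Suc t) \<union> f 1 ` nim_quads t"
  proof
    show "f 0 ` nim_quads (Suc t) \<union> f 1 ` nim_quads t \<subseteq> nim_quads (2 * Suc t)"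
      by (auto simp: f_def nim_quads_def xor_nat_double)
    show "nim_quads (2 * Suc t) \<subseteq> f 0 ` nim_quads (Suc t) \<union> f 1 ` nim_quads t"
    proof
      fix q assume q: "q \<in> nim_quads (2 * Suc t)"
      obtain a b c d where [simp]: "q = (a, b, c, d)" by (cases q)
      let ?q = "(a div 2, b div 2, c div 2, d div 2)"
      have abcd: "a + b = 2 * Suc t" "c + d = 2 * Suc t" "a XOR b = c XOR d"
        using q by (auto simp: nim_quads_def)
      have half: "a div 2 XOR b div 2 = c div 2 XOR d div 2"
        using abcd(3) by (simp flip: xor_nat_div_2)
      \<comment> \<open>XOR and sum have the same parity, so \<open>half\<close> ties the two pairs
        together; with \<open>sum\<close> this forces their lowest bits to agree.\<close>
      then have par: "even (a div 2 + b div 2) \<longleftrightarrow> even (c div 2 + d div 2)"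
        by (metis even_xor_nat_iff)
      have mod: "a mod 2 = b mod 2" "c mod 2 = d mod 2" using abcd(1,2) by presburger+
      have sum: "a div 2 + b div 2 + a mod 2 = Suc t" "c div 2 + d div 2 + c mod 2 = Suc t"
      proof -
        have "x div 2 + y div 2 + x mod 2 = Suc t" if "x + y = 2 * Suc t" "x mod 2 = y mod 2" for x y
        proof -
          have "2 * (x div 2 + y div 2 + x mod 2) = (2 * (x div 2) + x mod 2) + (2 * (y div 2) + y mod 2)"
            by (simp only: that(2)) simp
          with that(1) show ?thesis by simp
        qed
        with abcd(1,2) mod show "a div 2 + b div 2 + a mod 2 = Suc t"
          "c div 2 + d div 2 + c mod 2 = Suc t" by blast+
      qed
      have mod_ac: "a mod 2 = c mod 2"
        using par sum by (metis even_add even_mod_2_iff mod2_eq_if)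
      have q_eq: "q = f (a mod 2) ?q"
      proof -
        have "x = 2 * (x div 2) + x mod 2" for x :: nat by simp
        from this[of a] this[of b] this[of c] this[of d] show ?thesis
          unfolding f_def by (simp flip: mod mod_ac)
      qed
      show "q \<in> f 0 ` nim_quads (Suc t) \<union> f 1 ` nim_quads t"
      proof (cases "even a")
        case True
        then have "q = f 0 ?q" "?q \<in> nim_quads (Suc t)"
          using q_eq sum mod_ac half by (simp_all add: nim_quads_def mod_2_eq_odd)
        then show ?thesis by blast
      next
        case False
        then have "q = f 1 ?q" "?q \<in> nim_quads t"
          using q_eq sum mod_ac half by (simp_all add: nim_quads_def mod_2_eq_odd)
        then show ?thesis by blast
      qed
    qed
  qed
  then show ?thesis using disj by (simp add: card_Un_disjoint card_image[OF inj])
qed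

section \<open>Summation up to powers of two\<close>

lemma card_nim_quads_0: "card (nim_quads 0) = 1"
proof -
  have "nim_quads 0 = {(0, 0, 0, 0)}" by (auto simp: nim_quads_def)
  then show ?thesis by simp
qed

text \<open>All binary digits of \<open>2 ^ n - 1\<close> are 1, so only the odd recursion applies.
  This evaluates the correction term in the doubling formula for the sums.\<close>

lemma card_nim_quads_pow2: "card (nim_quads (2 ^ n - 1)) = 4 ^ n"
proof (induction n)
  case 0
  show ?case by (simp add: card_nim_quads_0)
next
  case (Suc n)
  have "2 ^ Suc n - 1 = Suc (2 * (2 ^ n - 1 :: nat))"
    using one_le_power[of "2 :: nat" n] unfolding power_Suc by linarith
  then show ?case using Suc by (simp only: card_nim_quads_odd power_Suc)
qed

text \<open>The last summand is moved to the left, as natural subtraction truncates.\<close>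

lemma sum_card_nim_quads_double:
  "(\<Sum>s<2 * Suc N. card (nim_quads s)) + card (nim_quads N) = 6 * (\<Sum>s<Suc N. card (nim_quads s))"
proof (induction N)
  case 0
  show ?case using card_nim_quads_odd[of 0] by (simp add: card_nim_quads_0 eval_nat_numeral)
next
  case (Suc N)
  have "(\<Sum>s<2 * Suc (Suc N). card (nim_quads s)) = (\<Sum>s<2 * Suc N. card (nim_quads s))
      + card (nim_quads (2 * Suc N)) + card (nim_quads (Suc (2 * Suc N)))"
    by simp
  moreover have "(\<Sum>s<Suc (Suc N). card (nim_quads s)) =
      (\<Sum>s<Suc N. card (nim_quads s)) + card (nim_quads (Suc N))"
    by simp
  \<comment> \<open>With \<open>F\<close> for the cardinality, the left side grows by
    \<open>(F (N + 1) + F N) + 4 * F (N + 1) + (F (N + 1) - F N)\<close>, which is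
    \<open>6 * F (N + 1)\<close>.\<close>
  ultimately show ?case using Suc unfolding card_nim_quads_even card_nim_quads_odd by linarith
qed

lemma sum_card_nim_quads: "2 * (\<Sum>s<2 ^ n. card (nim_quads s)) = 4 ^ n + 6 ^ n"
proof (induction n)
  case 0
  show ?case by (simp add: card_nim_quads_0)
next
  case (Suc n)
  have "Suc (2 ^ n - 1) = (2 ^ n :: nat)" by simp
  with sum_card_nim_quads_double[of "2 ^ n - 1"]
  have "(\<Sum>s<2 ^ Suc n. card (nim_quads s)) + 4 ^ n = 6 * (\<Sum>s<2 ^ n. card (nim_quads s))"
    by (simp add: card_nim_quads_pow2[simplified])
  \<comment> \<open>Doubling turns this into \<open>6 * (4 ^ n + 6 ^ n) - 2 * 4 ^ n\<close>, and the
    powers of 4 combine to \<open>4 ^ Suc n\<close>.\<close>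
  with Suc show ?case by simp
qed

theorem theorem5:
  fixes n :: nat
  assumes "n \<ge> 1"
  shows "(\<Sum>m = 1..2 ^ n. real (g m)) = (4 ^ n + 6 ^ n) / 2"
proof -
  have "(\<Sum>m = 1..2 ^ n. real (g m)) = (\<Sum>s<2 ^ n. real (card (nim_quads s)))"
    by (simp only: One_nat_def sum.atLeast1_atMost_eq g_Suc)
  also have "\<dots> = (4 ^ n + 6 ^ n) / 2"
    using arg_cong[OF sum_card_nim_quads[of n], of real] by simp
  finally show ?thesis .
qed

end
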